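(* Let $m\ge 1$, $\Delta t>0$, and $u_h^{n-1}\in V_h$, and let $u_h^n\in V_h$ be a solution of the fully discrete semi-implicit log-density scheme $$\mathcal{M}\left(\frac{\exp(u_h^n)-\exp(u_h^{n-1})}{\Delta t},v_h\right)+\mathcal{A}\left(m\exp(m u_h^{n-1});u_h^n,v_h\right)=0\qquad\text{for all } v_h\in V_h .$$ Then the scheme (i) conserves mass: $\mathcal{M}(\exp(u_h^n),1)=\mathcal{M}(\exp(u_h^{n-1}),1)$; (ii) preserves positivity: the discrete density $\exp(u_h^n)$ is positive everywhere in $\Omega$; (iii) dissipates energy in the form $$E_h^n-E_h^{n-1}\le -\int_{\Omega} m\,\Delta t\,\exp(m u_h^{n-1})\,|\nabla u_h^n|^2\,dx,$$ where $E_h^j:=\mathcal{M}(\exp(u_h^j),u_h^j-1)$ for $j\in\{n-1,n\}$.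
   Context: $\Omega\subset\mathbb{R}^d$, $d\in\{1,2,3\}$, is a bounded polyhedral domain, and $\Omega_h$ is a conforming simplicial triangulation of $\Omega$. The finite element space is $V_h=\{v_h\in H^1(\Omega): v_h|_K\in P_1(K)\ \text{for all } K\in\Omega_h\}$, where $P_1(K)$ denotes the polynomials of degree at most one on the simplex $K$. The operators are $$\mathcal{M}(\alpha,\beta)=\int_\Omega \alpha\,\beta\,dx,\qquad \mathcal{A}(\gamma;\alpha,\beta)=\int_\Omega \gamma\,\nabla\alpha\cdot\nabla\beta\,dx .$$ The scheme discretizes the porous medium equation $\partial_t\rho=\nabla\cdot\nabla(\rho^m)$ with homogeneous Neumann boundary condition, written in the log-density variable $u=\log\rho$; the discrete density at time $t^n=t^{n-1}+\Delta t$ is $\exp(u_h^n)$. *)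

theory Defs
  imports "HOL-Analysis.Analysis"
begin

text \<open>
  The space \<open>\<real>\<^sup>d\<close> is an arbitrary type \<open>'a::euclidean_space\<close> with \<open>d = DIM('a)\<close>. Elements of
  \<open>L\<^sup>2(\<Omega>)\<close> and \<open>H\<^sup>1(\<Omega>)\<close> are represented by functions on the whole type; their values off \<open>\<Omega>\<close>
  and on null sets are irrelevant.
\<close>

text \<open>
  Requiring the boundary pieces to have dimension exactly \<open>d - 1\<close> excludes isolated punctures
  and other cracks of dimension below \<open>d - 1\<close>. Neither convexity nor Lipschitz regularity is required.
\<close>

definition bounded_polyhedral_domain :: "'a::euclidean_space set \<Rightarrow> bool" where
  "bounded_polyhedral_domain \<Omega> \<longleftrightarrow>
     open \<Omega> \<and> connected \<Omega> \<and> \<Omega> \<noteq> {} \<and> bounded \<Omega> \<and>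
     (\<exists>\<F>. finite \<F> \<and> (\<forall>F\<in>\<F>. polytope F \<and> aff_dim F = int DIM('a) - 1) \<and> frontier \<Omega> = \<Union>\<F>)"

text \<open>
  The library predicate \<open>triangulation\<close> contains conformity: two simplices meet in a common
  (possibly empty) face. The simplices are closed.
\<close>

definition conforming_triangulation :: "'a::euclidean_space set \<Rightarrow> 'a set set \<Rightarrow> bool" where
  "conforming_triangulation \<Omega> \<T> \<longleftrightarrow>
     triangulation \<T> \<and> (\<forall>K\<in>\<T>. int DIM('a) simplex K) \<and> \<Union>\<T> = closure \<Omega>"

primrec k_times_cont_diff :: "nat \<Rightarrow> ('a::euclidean_space \<Rightarrow> real) \<Rightarrow> bool" where
  "k_times_cont_diff 0 \<phi> \<longleftrightarrow> continuous_on UNIV \<phi>"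
| "k_times_cont_diff (Suc k) \<phi> \<longleftrightarrow>
     (\<forall>x. \<phi> differentiable (at x)) \<and>
     (\<forall>b\<in>Basis. k_times_cont_diff k (\<lambda>x. frechet_derivative \<phi> (at x) b))"

text \<open>The space \<open>C\<^sub>c\<^sup>\<infinity>(\<Omega>)\<close>, its elements being extended by zero.\<close>

definition test_functions :: "'a::euclidean_space set \<Rightarrow> ('a \<Rightarrow> real) set" where
  "test_functions \<Omega> =
     {\<phi>. (\<forall>k. k_times_cont_diff k \<phi>) \<and>
         compact (closure {x. \<phi> x \<noteq> 0}) \<and> closure {x. \<phi> x \<noteq> 0} \<subseteq> \<Omega>}"

definition L2 :: "'a::euclidean_space set \<Rightarrow> ('a \<Rightarrow> 'b::euclidean_space) set" where
  "L2 \<Omega> = {f. set_borel_measurable lebesgue \<Omega> f \<and>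
              set_integrable lebesgue \<Omega> (\<lambda>x. (norm (f x))\<^sup>2)}"

definition is_weak_gradient :: "'a::euclidean_space set \<Rightarrow> ('a \<Rightarrow> real) \<Rightarrow> ('a \<Rightarrow> 'a) \<Rightarrow> bool" where
  "is_weak_gradient \<Omega> v g \<longleftrightarrow>
     g \<in> L2 \<Omega> \<and>
     (\<forall>\<phi>\<in>test_functions \<Omega>. \<forall>b\<in>Basis.
        (LINT x:\<Omega>|lebesgue. v x * frechet_derivative \<phi> (at x) b) =
        - (LINT x:\<Omega>|lebesgue. (g x \<bullet> b) * \<phi> x))"

definition H1 :: "'a::euclidean_space set \<Rightarrow> ('a \<Rightarrow> real) set" where
  "H1 \<Omega> = {v. v \<in> L2 \<Omega> \<and> (\<exists>g. is_weak_gradient \<Omega> v g)}"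

text \<open>Weak gradients are unique up to null sets, so the choice of representative is immaterial.\<close>

definition weak_grad :: "'a::euclidean_space set \<Rightarrow> ('a \<Rightarrow> real) \<Rightarrow> 'a \<Rightarrow> 'a" where
  "weak_grad \<Omega> v = (SOME g. is_weak_gradient \<Omega> v g)"

definition P1 :: "('a::euclidean_space \<Rightarrow> real) set" where
  "P1 = {p. \<exists>c a. \<forall>x. p x = c + a \<bullet> x}"

text \<open>
  As for any \<open>H\<^sup>1\<close> function, the restriction to \<open>K\<close> is understood up to null sets. Continuity
  across interior faces is enforced by membership in \<open>H\<^sup>1(\<Omega>)\<close>.
\<close>

definition V_h :: "'a::euclidean_space set \<Rightarrow> 'a set set \<Rightarrow> ('a \<Rightarrow> real) set" where
  "V_h \<Omega> \<T> = {v \<in> H1 \<Omega>. \<forall>K\<in>\<T>. \<exists>p\<in>P1. AE x in lebesgue. x \<in> K \<longrightarrow> v x = p x}"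

definition \<M> :: "'a::euclidean_space set \<Rightarrow> ('a \<Rightarrow> real) \<Rightarrow> ('a \<Rightarrow> real) \<Rightarrow> real" where
  "\<M> \<Omega> \<alpha> \<beta> = (LINT x:\<Omega>|lebesgue. \<alpha> x * \<beta> x)"

definition \<A> :: "'a::euclidean_space set \<Rightarrow> ('a \<Rightarrow> real) \<Rightarrow> ('a \<Rightarrow> real) \<Rightarrow> ('a \<Rightarrow> real) \<Rightarrow> real" where
  "\<A> \<Omega> \<gamma> \<alpha> \<beta> = (LINT x:\<Omega>|lebesgue. \<gamma> x * (weak_grad \<Omega> \<alpha> x \<bullet> weak_grad \<Omega> \<beta> x))"

definition energy :: "'a::euclidean_space set \<Rightarrow> ('a \<Rightarrow> real) \<Rightarrow> real" where
  "energy \<Omega> u = \<M> \<Omega> (\<lambda>x. exp (u x)) (\<lambda>x. u x - 1)"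

end

theory Submission
  imports Defs "HOL-Real_Asymp.Real_Asymp"
begin

text \<open>
  Mass conservation is the scheme tested with \<open>v = 1\<close>, energy dissipation the scheme tested with
  \<open>v = u_new\<close> combined with the convexity of \<open>s \<mapsto> s * ln s - s\<close>.
  Testing with \<open>1\<close> makes the elliptic term vanish only because weak gradients are unique up to null
  sets: \<open>weak_grad \<Omega> 1\<close> is an arbitrary choice among them. All integrals in the
  energy are finite because elements of \<open>V_h\<close> are essentially bounded, being affine on each of the
  finitely many compact simplices.
\<close>

subsection \<open>Smooth cutoff functions of boxes\<close>

text \<open>The log-density variable is what lets the continuous energy argument survive
  discretization: the derivative of s ln s - s at \<open>exp u_new\<close> is \<open>u_new\<close>
  itself, an element of the finite element space and so an admissible test function. Because it is
  taken at the new time, convexity points in the right direction, and the lagged coefficient enters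
  only as a weight. The bulk of the work is uniqueness of weak gradients, which asks two things of
  test functions: their partial derivatives have mean zero, so that the zero field is a weak
  gradient of a constant, and there are enough of them to detect a nonzero integrable function.
  Membership in \<open>test_functions\<close> demands iterated partial derivatives of every order,
  so explicit bumps have to come from a class closed under differentiation; exp(-1/t) and its
  derivatives generate one. Boxes are used because their bumps are products of one-variable
  functions and because boxes form an intersection-stable generator of the Borel sets.\<close>

definition exp_cutoff :: "nat \<Rightarrow> real \<Rightarrow> real" where
  "exp_cutoff n t = (if t > 0 then exp (- inverse t) * inverse t ^ n else 0)"

lemma exp_cutoff_tendsto_0: "(exp_cutoff n \<longlongrightarrow> 0) (at 0)"
proof -
  have "((\<lambda>t::real. (inverse t) ^ n / exp (inverse t)) \<longlongrightarrow> 0) (at_right 0)"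
    using filterlim_compose[OF tendsto_power_div_exp_0 filterlim_inverse_at_top_right] by simp
  moreover have "eventually (\<lambda>t::real. (inverse t) ^ n / exp (inverse t) = exp_cutoff n t) (at_right 0)"
    by (auto simp: eventually_at_filter exp_cutoff_def exp_minus field_simps)
  ultimately have "(exp_cutoff n \<longlongrightarrow> 0) (at_right 0)"
    by (rule Lim_transform_eventually)
  moreover have "(exp_cutoff n \<longlongrightarrow> 0) (at_left 0)"
    by (rule tendsto_eventually) (auto simp: eventually_at_filter exp_cutoff_def)
  ultimately show ?thesis
    by (simp add: filterlim_split_at)
qed

text \<open>The powers of 1/t exist for this formula: differentiating exp(-1/t) produces only
  further powers, so the family over all n is closed under differentiation up to linear
  combinations.\<close>

lemma exp_cutoff_has_derivative:
  "(exp_cutoff n has_real_derivative exp_cutoff (n + 2) t - real n * exp_cutoff (n + 1) t) (at t)"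
proof -
  consider "t < 0" | "t = 0" | "t > 0"
    by linarith
  then show ?thesis
  proof cases
    case 1
    have "((\<lambda>_. 0) has_real_derivative 0) (at t)"
      by simp
    then have "(exp_cutoff n has_real_derivative 0) (at t)"
      by (rule has_field_derivative_transform_within_open[of _ _ _ "{..<0}"])
        (use 1 in \<open>auto simp: exp_cutoff_def\<close>)
    with 1 show ?thesis
      by (simp add: exp_cutoff_def)
  next
    case 2
    \<comment> \<open>Dividing by h only raises the power of 1/h, so the difference quotient at 0 is
      again a member of the family, whose limit is known to be 0.\<close>
    have "(\<lambda>h. (exp_cutoff n (0 + h) - exp_cutoff n 0) / h) = exp_cutoff (Suc n)"
      by (auto simp: fun_eq_iff exp_cutoff_def field_simps)
    then have "(exp_cutoff n has_real_derivative 0) (at 0)"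
      using exp_cutoff_tendsto_0[of "Suc n"] by (simp add: DERIV_def)
    with 2 show ?thesis
      by (simp add: exp_cutoff_def)
  next
    case 3
    have "((\<lambda>t. exp (- inverse t) * inverse t ^ n) has_real_derivative
        exp (- inverse t) * inverse t ^ 2 * inverse t ^ n
        + exp (- inverse t) * (real n * inverse t ^ (n - 1) * - (inverse t ^ 2))) (at t)"
      using 3 by (auto intro!: derivative_eq_intros simp: power2_eq_square)
    \<comment> \<open>The case n = 0 is separate because \<open>n - 1\<close> is truncated; the
      factor \<open>real n\<close> then removes the term.\<close>
    also have "exp (- inverse t) * inverse t ^ 2 * inverse t ^ n
        + exp (- inverse t) * (real n * inverse t ^ (n - 1) * - (inverse t ^ 2))
        = exp_cutoff (n + 2) t - real n * exp_cutoff (n + 1) t"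
      using 3 by (cases n) (simp_all add: exp_cutoff_def power2_eq_square)
    finally have "((\<lambda>t. exp (- inverse t) * inverse t ^ n) has_real_derivative
        exp_cutoff (n + 2) t - real n * exp_cutoff (n + 1) t) (at t)" .
    then show ?thesis
      by (rule has_field_derivative_transform_within_open[of _ _ _ "{0<..}"])
        (use 3 in \<open>auto simp: exp_cutoff_def\<close>)
  qed
qed

text \<open>Closure under directional derivatives turns smoothness of every order into one induction
  on the order. Affine arguments suffice, since box bumps are products of functions of single
  coordinates.\<close>

inductive_set cutoff_algebra :: "('a::euclidean_space \<Rightarrow> real) set" where
  const: "(\<lambda>_. c) \<in> cutoff_algebra"
| cutoff: "(\<lambda>x. exp_cutoff n (w \<bullet> x + c)) \<in> cutoff_algebra"
| add: "f \<in> cutoff_algebra \<Longrightarrow> g \<in> cutoff_algebra \<Longrightarrow> (\<lambda>x. f x + g x) \<in> cutoff_algebra"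
| mult: "f \<in> cutoff_algebra \<Longrightarrow> g \<in> cutoff_algebra \<Longrightarrow> (\<lambda>x. f x * g x) \<in> cutoff_algebra"

lemma cutoff_algebra_has_derivative:
  assumes "f \<in> cutoff_algebra"
  shows "\<exists>D. (\<forall>x. (f has_derivative D x) (at x)) \<and> (\<forall>v. (\<lambda>x. D x v) \<in> cutoff_algebra)"
  using assms
proof induction
  case (const c)
  show ?case
    by (rule exI[of _ "\<lambda>x v. 0"]) (auto intro: cutoff_algebra.const)
next
  case (cutoff n w c)
  \<comment> \<open>The sum with the factor \<open>- real n\<close> replaces a difference so that
    the introduction rules, which have no clause for subtraction, apply directly.\<close>
  define D where "D x v = (exp_cutoff (n + 2) (w \<bullet> x + c) + (- real n) * exp_cutoff (n + 1) (w \<bullet> x + c)) * (w \<bullet> v)"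
    for x v :: 'a
  have "((\<lambda>x. exp_cutoff n (w \<bullet> x + c)) has_derivative D x) (at x)" for x
  proof -
    have "((\<lambda>x. w \<bullet> x + c) has_derivative (\<lambda>v. w \<bullet> v)) (at x)"
      by (auto intro!: derivative_eq_intros)
    from DERIV_compose_FDERIV[OF exp_cutoff_has_derivative this]
    show ?thesis
      by (simp add: D_def[abs_def] mult_ac)
  qed
  moreover have "(\<lambda>x. D x v) \<in> cutoff_algebra" for v
    unfolding D_def by (intro cutoff_algebra.intros)
  ultimately show ?case
    by blast
next
  case (add f g)
  then obtain F G where
    "\<And>x. (f has_derivative F x) (at x)" "\<And>v. (\<lambda>x. F x v) \<in> cutoff_algebra"
    "\<And>x. (g has_derivative G x) (at x)" "\<And>v. (\<lambda>x. G x v) \<in> cutoff_algebra"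
    by blast
  then show ?case
    by (intro exI[of _ "\<lambda>x v. F x v + G x v"]) (auto intro: has_derivative_add cutoff_algebra.add)
next
  case (mult f g)
  then obtain F G where
    F: "\<And>x. (f has_derivative F x) (at x)" "\<And>v. (\<lambda>x. F x v) \<in> cutoff_algebra" and
    G: "\<And>x. (g has_derivative G x) (at x)" "\<And>v. (\<lambda>x. G x v) \<in> cutoff_algebra"
    by blast
  define D where "D x v = f x * G x v + F x v * g x" for x v
  have "((\<lambda>x. f x * g x) has_derivative D x) (at x)" for x
    unfolding D_def by (rule has_derivative_mult[OF F(1) G(1)])
  moreover have "(\<lambda>x. D x v) \<in> cutoff_algebra" for v
    unfolding D_def
    by (rule cutoff_algebra.add[OF cutoff_algebra.mult[OF mult.hyps(1) G(2)] cutoff_algebra.mult[OF F(2) mult.hyps(2)]])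
  ultimately show ?case
    by blast
qed

lemma cutoff_algebra_smooth:
  "f \<in> cutoff_algebra \<Longrightarrow> k_times_cont_diff k f"
proof (induction k arbitrary: f)
  case 0
  then obtain D where "\<forall>x. (f has_derivative D x) (at x)"
    using cutoff_algebra_has_derivative by metis
  then have "isCont f x" for x
    using has_derivative_continuous by blast
  then show ?case
    by (simp add: continuous_at_imp_continuous_on)
next
  case (Suc k)
  from cutoff_algebra_has_derivative[OF Suc.prems] obtain D where
    D: "\<And>x. (f has_derivative D x) (at x)" "\<And>v. (\<lambda>x. D x v) \<in> cutoff_algebra"
    by blast
  have "frechet_derivative f (at x) = D x" for x
    using frechet_derivative_at[OF D(1)] by simp
  moreover have "f differentiable at x" for x
    using D(1) by (rule differentiableI)
  ultimately show ?case
    using D(2) Suc.IH by simp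
qed

lemma cutoff_algebra_prod:
  "finite I \<Longrightarrow> (\<And>i. i \<in> I \<Longrightarrow> f i \<in> cutoff_algebra) \<Longrightarrow> (\<lambda>x. \<Prod>i\<in>I. f i x) \<in> cutoff_algebra"
  by (induction I rule: finite_induct) (auto intro: cutoff_algebra.intros)

text \<open>The factor n drives the arguments to infinity inside the box, where
  \<open>exp_cutoff 0\<close> tends to 1. The shift by 1 keeps the support at distance 1/n from
  every face, so that even its closure lies in the open box.\<close>

definition box_cutoff :: "'a::euclidean_space \<Rightarrow> 'a \<Rightarrow> nat \<Rightarrow> 'a \<Rightarrow> real" where
  "box_cutoff a b n x =
     (\<Prod>i\<in>Basis. exp_cutoff 0 (real n * (x \<bullet> i - a \<bullet> i) - 1) * exp_cutoff 0 (real n * (b \<bullet> i - x \<bullet> i) - 1))"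

lemma box_cutoff_smooth: "k_times_cont_diff k (box_cutoff a b n)"
proof -
  have 1: "real n * (x \<bullet> i - a \<bullet> i) - 1 = (real n *\<^sub>R i) \<bullet> x + (- real n * (a \<bullet> i) - 1)" for x i :: 'a
    by (simp add: algebra_simps inner_commute)
  have 2: "real n * (b \<bullet> i - x \<bullet> i) - 1 = (- real n *\<^sub>R i) \<bullet> x + (real n * (b \<bullet> i) - 1)" for x i :: 'a
    by (simp add: algebra_simps inner_commute)
  have "box_cutoff a b n \<in> cutoff_algebra"
    unfolding box_cutoff_def[abs_def] 1 2
    by (intro cutoff_algebra_prod cutoff_algebra.mult cutoff_algebra.cutoff) auto
  then show ?thesis
    by (rule cutoff_algebra_smooth)
qed

lemma exp_cutoff_0_nonneg: "0 \<le> exp_cutoff 0 t"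
  and exp_cutoff_0_le_1: "exp_cutoff 0 t \<le> 1"
  by (auto simp: exp_cutoff_def)

lemma box_cutoff_nonneg: "0 \<le> box_cutoff a b n x"
  and box_cutoff_le_1: "box_cutoff a b n x \<le> 1"
  by (auto simp: box_cutoff_def intro!: prod_nonneg prod_le_1 mult_nonneg_nonneg mult_le_one
      exp_cutoff_0_nonneg exp_cutoff_0_le_1)

lemma box_cutoff_nonzeroD:
  assumes "box_cutoff a b n x \<noteq> 0" "i \<in> Basis"
  shows "n \<noteq> 0" "a \<bullet> i + 1 / n \<le> x \<bullet> i" "x \<bullet> i \<le> b \<bullet> i - 1 / n"
proof -
  have *: "1 < real n * (x \<bullet> i - a \<bullet> i)" "1 < real n * (b \<bullet> i - x \<bullet> i)"
    using assms by (auto simp: box_cutoff_def exp_cutoff_def split: if_splits)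
  then show n: "n \<noteq> 0"
    by (cases "n = 0") auto
  have "1 / n < x \<bullet> i - a \<bullet> i" "1 / n < b \<bullet> i - x \<bullet> i"
    using * n by (simp_all add: divide_less_eq mult.commute)
  then show "a \<bullet> i + 1 / n \<le> x \<bullet> i" "x \<bullet> i \<le> b \<bullet> i - 1 / n"
    by linarith+
qed

lemma closure_support_box_cutoff: "closure {x. box_cutoff a b n x \<noteq> 0} \<subseteq> box a b"
proof -
  have "{x. box_cutoff a b n x \<noteq> 0} \<subseteq> cbox (a + (\<Sum>i\<in>Basis. (1 / n) *\<^sub>R i)) (b - (\<Sum>i\<in>Basis. (1 / n) *\<^sub>R i))"
    using box_cutoff_nonzeroD[of a b n]
    by (auto simp: mem_box inner_add_left inner_diff_left)
  then have *: "closure {x. box_cutoff a b n x \<noteq> 0} \<subseteq> \<dots>"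
    by (rule closure_minimal) (rule closed_cbox)
  show ?thesis
  \<comment> \<open>For n = 0 the margin \<open>1 / n\<close> evaluates to 0 and the closed box is
    no help; but then every argument is -1 and the cutoff vanishes identically.\<close>
  proof (cases "n = 0")
    case True
    then have "{x. box_cutoff a b n x \<noteq> 0} = {}"
      using box_cutoff_nonzeroD(1)[of a b n] nonempty_Basis by blast
    then show ?thesis
      by simp
  next
    case False
    then have "0 < 1 / real n"
      by simp
    show ?thesis
    proof
      fix x assume "x \<in> closure {x. box_cutoff a b n x \<noteq> 0}"
      with * have x: "x \<in> cbox (a + (\<Sum>i\<in>Basis. (1 / n) *\<^sub>R i)) (b - (\<Sum>i\<in>Basis. (1 / n) *\<^sub>R i))"
        by blast
      have "a \<bullet> i < x \<bullet> i \<and> x \<bullet> i < b \<bullet> i" if "i \<in> Basis" for i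
      proof -
        have "a \<bullet> i + 1 / n \<le> x \<bullet> i" "x \<bullet> i \<le> b \<bullet> i - 1 / n"
          using x that by (auto simp: mem_box inner_add_left inner_diff_left)
        with \<open>0 < 1 / real n\<close> show ?thesis
          by linarith
      qed
      then show "x \<in> box a b"
        by (simp add: mem_box)
    qed
  qed
qed

lemma box_cutoff_eq_0: "x \<notin> box a b \<Longrightarrow> box_cutoff a b n x = 0"
  using closure_support_box_cutoff[of a b n] closure_subset[of "{x. box_cutoff a b n x \<noteq> 0}"] by blast

lemma box_cutoff_test_function:
  assumes "box a b \<subseteq> \<Omega>"
  shows "box_cutoff a b n \<in> test_functions \<Omega>"
proof -
  have "bounded (closure {x. box_cutoff a b n x \<noteq> 0})"
    by (rule bounded_subset[OF bounded_box closure_support_box_cutoff])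
  then have "compact (closure {x. box_cutoff a b n x \<noteq> 0})"
    by (simp only: compact_eq_bounded_closed closed_closure simp_thms)
  with box_cutoff_smooth order_trans[OF closure_support_box_cutoff assms] show ?thesis
    unfolding test_functions_def by blast
qed

lemma box_cutoff_tendsto: "(\<lambda>n. box_cutoff a b n x) \<longlonglongrightarrow> indicator (box a b) x"
proof (cases "x \<in> box a b")
  case True
  have lim: "(\<lambda>n. exp_cutoff 0 (real n * t - 1)) \<longlonglongrightarrow> 1" if "t > 0" for t :: real
  proof -
    have top: "filterlim (\<lambda>n. real n * t - 1) at_top sequentially"
      using that by real_asymp
    have "((\<lambda>s::real. exp (- inverse s)) \<longlongrightarrow> 1) at_top"
      by real_asymp
    moreover have "eventually (\<lambda>s::real. exp (- inverse s) = exp_cutoff 0 s) at_top"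
      using eventually_gt_at_top[of 0] by eventually_elim (simp add: exp_cutoff_def)
    ultimately have "(exp_cutoff 0 \<longlongrightarrow> 1) at_top"
      by (rule Lim_transform_eventually)
    from filterlim_compose[OF this top] show ?thesis .
  qed
  have "(\<lambda>n. box_cutoff a b n x) \<longlonglongrightarrow> (\<Prod>i\<in>(Basis :: 'a set). 1 * 1)"
    unfolding box_cutoff_def by (intro tendsto_prod tendsto_mult lim) (use True in \<open>auto simp: mem_box\<close>)
  with True show ?thesis
    by simp
qed (simp add: box_cutoff_eq_0)

subsection \<open>Uniqueness of weak gradients\<close>

lemma continuous_imp_borel_measurable_lebesgue:
  "continuous_on UNIV f \<Longrightarrow> f \<in> borel_measurable lebesgue"
  by (intro measurable_completion) (simp add: borel_measurable_continuous_onI)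

text \<open>Dynkin's argument: boxes are an intersection-stable generator of the Borel sets, and the
  sets over which f integrates to 0 are closed under complements and countable disjoint unions.
  Complements need \<open>total\<close>, as the whole space is not a box. A Lebesgue set differs
  from a Borel set by a null set, so the integral vanishes over it too.\<close>

lemma AE_eq_0_if_box_integrals_eq_0:
  fixes f :: "'a::euclidean_space \<Rightarrow> real"
  assumes f: "integrable lebesgue f" and total: "integral\<^sup>L lebesgue f = 0"
    and box: "\<And>a b. (LINT x:box a b|lebesgue. f x) = 0"
  shows "AE x in lebesgue. f x = 0"
proof (rule sigma_finite_measure.density_zero[OF _ f])
  show "sigma_finite_measure (lebesgue :: 'a measure)"
    using lborel.sigma_finite_countable by unfold_locales (fastforce simp: emeasure_completion)
next
  have int: "set_integrable lebesgue S f" if "S \<in> sets lebesgue" for S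
    using integrable_mult_indicator[OF that f] by (simp only: set_integrable_def)
  have borel: "(LINT x:S|lebesgue. f x) = 0" if "S \<in> sets borel" for S
  proof -
    have "Int_stable (range (\<lambda>(a, b). box a b :: 'a set))"
      by (auto simp: Int_stable_def box_Int_box)
    moreover have "range (\<lambda>(a, b). box a b :: 'a set) \<subseteq> Pow UNIV"
      by auto
    moreover have "S \<in> sigma_sets UNIV (range (\<lambda>(a, b). box a b))"
      using that unfolding borel_eq_box by simp
    ultimately show ?thesis
    proof (induction rule: sigma_sets_induct_disjoint)
      case (basic A)
      then show ?case
        using box by auto
    next
      case empty
      then show ?case
        by (simp add: set_lebesgue_integral_def)
    next
      case (compl A)
      then have "A \<in> sets borel"
        by (simp add: borel_eq_box)
      then have A: "A \<in> sets lebesgue"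
        by auto
      then have "UNIV - A \<in> sets lebesgue"
        using sets.compl_sets[OF A] by simp
      with A have "(LINT x:A \<union> (UNIV - A)|lebesgue. f x) = (LINT x:A|lebesgue. f x) + (LINT x:UNIV - A|lebesgue. f x)"
        using int by (intro set_integral_Un) auto
      moreover have "(LINT x:A \<union> (UNIV - A)|lebesgue. f x) = 0"
        using total by (simp add: set_lebesgue_integral_def)
      ultimately show ?case
        using compl by simp
    next
      case (union A)
      then have "A i \<in> sets borel" for i
        by (auto simp: borel_eq_box)
      then have A: "A i \<in> sets lebesgue" for i
        by auto
      have "(LINT x:(\<Union>i. A i)|lebesgue. f x) = (\<Sum>i. (LINT x:A i|lebesgue. f x))"
        by (rule lebesgue_integral_countable_add)
          (use A int union in \<open>auto simp: disjoint_family_on_def\<close>)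
      with union show ?case
        by simp
    qed
  qed
  fix S :: "'a set" assume S: "S \<in> sets lebesgue"
  then obtain T N N' where T: "S = T \<union> N" "N \<subseteq> N'" "N' \<in> null_sets lborel" "T \<in> sets lborel"
    by (rule sets_completionE)
  have "AE x in lebesgue. x \<notin> N'"
    using T(3) by (intro AE_completion AE_not_in)
  then have "AE x in lebesgue. x \<in> S \<longleftrightarrow> x \<in> T"
    by eventually_elim (use T in auto)
  moreover have "set_borel_measurable lebesgue A f" if "A \<in> sets lebesgue" for A
    using int[OF that] unfolding set_integrable_def set_borel_measurable_def
    by (rule borel_measurable_integrable)
  ultimately have "(LINT x:S|lebesgue. f x) = (LINT x:T|lebesgue. f x)"
    using S sets_completionI_sets[OF T(4)] by (intro set_integral_cong_set) auto
  with borel T(4) show "(LINT x:S|lebesgue. f x) = 0"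
    by simp
qed

text \<open>
  The smooth functions \<open>box_cutoff a b n\<close> converge boundedly to the indicator of the box, which
  reduces the fundamental lemma of the calculus of variations to integrals over boxes.
\<close>

lemma fundamental_lemma_calculus_of_variations:
  fixes f :: "'a::euclidean_space \<Rightarrow> real"
  assumes "open \<Omega>" and f: "set_integrable lebesgue \<Omega> f"
    and test: "\<And>\<phi>. \<phi> \<in> test_functions \<Omega> \<Longrightarrow> (LINT x:\<Omega>|lebesgue. f x * \<phi> x) = 0"
  shows "AE x in lebesgue. x \<in> \<Omega> \<longrightarrow> f x = 0"
proof -
  have box0: "(LINT x:box a b|lebesgue. f x) = 0" if sub: "box a b \<subseteq> \<Omega>" for a b
  proof -
    have meas: "box_cutoff a b n \<in> borel_measurable lebesgue" for n
      using box_cutoff_smooth[of 0 a b n] by (simp add: continuous_imp_borel_measurable_lebesgue)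
    have "(\<lambda>n. LINT x|lebesgue. (indicator \<Omega> x *\<^sub>R f x) * box_cutoff a b n x) \<longlonglongrightarrow>
        (LINT x|lebesgue. (indicator \<Omega> x *\<^sub>R f x) * indicator (box a b) x)"
    proof (rule integral_dominated_convergence[where w = "\<lambda>x. norm (indicator \<Omega> x *\<^sub>R f x)"])
      show "integrable lebesgue (\<lambda>x. norm (indicator \<Omega> x *\<^sub>R f x))"
        using f unfolding set_integrable_def by (rule integrable_norm)
      have m: "(\<lambda>x. indicator \<Omega> x *\<^sub>R f x) \<in> borel_measurable lebesgue"
        using f unfolding set_integrable_def by (rule borel_measurable_integrable)
      show "(\<lambda>x. (indicator \<Omega> x *\<^sub>R f x) * indicator (box a b) x) \<in> borel_measurable lebesgue"
        by (intro borel_measurable_times m borel_measurable_indicator fmeasurableD lmeasurable_box)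
      show "(\<lambda>x. (indicator \<Omega> x *\<^sub>R f x) * box_cutoff a b n x) \<in> borel_measurable lebesgue" for n
        by (intro borel_measurable_times m meas)
      show "AE x in lebesgue. (\<lambda>n. (indicator \<Omega> x *\<^sub>R f x) * box_cutoff a b n x) \<longlonglongrightarrow>
          (indicator \<Omega> x *\<^sub>R f x) * indicator (box a b) x"
        by (intro AE_I2 tendsto_mult tendsto_const box_cutoff_tendsto)
      show "AE x in lebesgue. norm ((indicator \<Omega> x *\<^sub>R f x) * box_cutoff a b n x) \<le> norm (indicator \<Omega> x *\<^sub>R f x)" for n
        by (intro AE_I2) (use box_cutoff_nonneg[of a b n] box_cutoff_le_1[of a b n] in \<open>simp add: abs_mult mult_left_le\<close>)
    qed
    moreover have "(LINT x|lebesgue. (indicator \<Omega> x *\<^sub>R f x) * box_cutoff a b n x) = 0" for n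
      using test[OF box_cutoff_test_function[OF sub]] by (simp add: set_lebesgue_integral_def mult.assoc)
    ultimately have "(LINT x|lebesgue. (indicator \<Omega> x *\<^sub>R f x) * indicator (box a b) x) = 0"
      by (simp add: LIMSEQ_const_iff)
    also have "(\<lambda>x. (indicator \<Omega> x *\<^sub>R f x) * indicator (box a b) x) = (\<lambda>x. indicator (box a b) x *\<^sub>R f x)"
      using sub by (auto simp: fun_eq_iff indicator_def)
    finally show ?thesis
      by (simp add: set_lebesgue_integral_def)
  qed
  \<comment> \<open>\<open>AE_eq_0_if_box_integrals_eq_0\<close> wants a function on the whole space
    with total integral 0. Cutting f down to one box inside \<Omega> provides it, since any other
    box meets this one in a box that again lies in \<Omega>. Countably many such boxes exhaust
    \<Omega>.\<close>
  have local: "AE x in lebesgue. x \<in> box c d \<longrightarrow> f x = 0" if sub: "box c d \<subseteq> \<Omega>" for c d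
  proof -
    have "AE x in lebesgue. indicator (box c d) x *\<^sub>R f x = 0"
    proof (rule AE_eq_0_if_box_integrals_eq_0)
      show "integrable lebesgue (\<lambda>x. indicator (box c d) x *\<^sub>R f x)"
        using set_integrable_subset[OF f _ sub] by (simp add: set_integrable_def)
      show "(LINT x|lebesgue. indicator (box c d) x *\<^sub>R f x) = 0"
        using box0[OF sub] by (simp add: set_lebesgue_integral_def)
      show "(LINT x:box a b|lebesgue. indicator (box c d) x *\<^sub>R f x) = 0" for a b
      proof -
        obtain l u where lu: "box a b \<inter> box c d = box l u"
          by (simp add: box_Int_box)
        then have "(LINT x:box l u|lebesgue. f x) = 0"
          using sub by (intro box0) auto
        then show ?thesis
          unfolding lu[symmetric] by (simp add: set_lebesgue_integral_def indicator_inter_arith mult.assoc)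
      qed
    qed
    then show ?thesis
      by eventually_elim (auto simp: indicator_def split: if_splits)
  qed
  obtain \<D> where \<D>: "countable \<D>" "\<D> \<subseteq> Pow \<Omega>" "\<And>X. X \<in> \<D> \<Longrightarrow> \<exists>a b. X = box a b" "\<Union>\<D> = \<Omega>"
    using open_countable_Union_open_box[OF \<open>open \<Omega>\<close>] by blast
  have "AE x in lebesgue. \<forall>X\<in>\<D>. x \<in> X \<longrightarrow> f x = 0"
    unfolding AE_ball_countable[OF \<D>(1)] using \<D>(2,3) local by (metis PowD subsetD)
  then show ?thesis
    by eventually_elim (use \<D>(4) in blast)
qed

section \<open>Test functions and the mean of their derivatives\<close>

lemma test_functionD:
  assumes "\<phi> \<in> test_functions \<Omega>"
  shows "continuous_on UNIV \<phi>"
    and "(\<phi> has_derivative frechet_derivative \<phi> (at x)) (at x)"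
    and "b \<in> Basis \<Longrightarrow> continuous_on UNIV (\<lambda>x. frechet_derivative \<phi> (at x) b)"
    and "compact (closure {x. \<phi> x \<noteq> 0})"
    and "x \<notin> \<Omega> \<Longrightarrow> \<phi> x = 0"
    and "x \<notin> \<Omega> \<Longrightarrow> frechet_derivative \<phi> (at x) b = 0"
proof -
  have k: "k_times_cont_diff k \<phi>" for k
    using assms by (simp add: test_functions_def)
  have sub: "closure {x. \<phi> x \<noteq> 0} \<subseteq> \<Omega>"
    using assms by (simp add: test_functions_def)
  show "continuous_on UNIV \<phi>"
    using k[of 0] by simp
  show "(\<phi> has_derivative frechet_derivative \<phi> (at x)) (at x)"
    using k[of 1] by (simp add: frechet_derivative_works[symmetric])
  show "continuous_on UNIV (\<lambda>x. frechet_derivative \<phi> (at x) b)" if "b \<in> Basis"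
    using k[of 1] that by simp
  show "compact (closure {x. \<phi> x \<noteq> 0})"
    using assms by (simp add: test_functions_def)
  assume x: "x \<notin> \<Omega>"
  then show "\<phi> x = 0"
    using sub closure_subset[of "{x. \<phi> x \<noteq> 0}"] by blast
  \<comment> \<open>The complement of the closed support is an open neighbourhood of x on which
    \<phi> is 0; this covers frontier points of \<Omega> as well.\<close>
  have "((\<lambda>_. 0) has_derivative (\<lambda>_. 0)) (at x)"
    by simp
  then have "(\<phi> has_derivative (\<lambda>_. 0)) (at x)"
    by (rule has_derivative_transform_within_open[of _ _ _ _ "- closure {x. \<phi> x \<noteq> 0}"])
      (use x sub closure_subset[of "{x. \<phi> x \<noteq> 0}"] in auto)
  then show "frechet_derivative \<phi> (at x) b = 0"
    by (simp add: frechet_derivative_at[symmetric])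
qed

lemma continuous_compact_support_bounded:
  fixes f :: "'a::euclidean_space \<Rightarrow> real"
  assumes "continuous_on UNIV f" "compact K" "\<And>x. x \<notin> K \<Longrightarrow> f x = 0"
  obtains B where "0 \<le> B" "\<And>x. \<bar>f x\<bar> \<le> B"
proof -
  have "bounded (f ` K)"
    using assms by (intro compact_imp_bounded compact_continuous_image) (auto intro: continuous_on_subset)
  then obtain B where "0 < B" "\<And>x. x \<in> K \<Longrightarrow> \<bar>f x\<bar> \<le> B"
    by (auto simp: bounded_pos)
  then show ?thesis
    using assms(3) by (intro that[of B]) (auto, metis abs_zero less_imp_le)
qed

text \<open>
  By translation invariance the difference quotients of \<open>\<phi>\<close> have integral zero, and they converge
  boundedly on a common compact set.
\<close>

lemma integral_frechet_derivative_test_function: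
  fixes \<phi> :: "'a::euclidean_space \<Rightarrow> real"
  assumes \<phi>: "\<phi> \<in> test_functions \<Omega>" and b: "b \<in> Basis"
  shows "(LINT x:\<Omega>|lebesgue. frechet_derivative \<phi> (at x) b) = 0"
proof -
  note D = test_functionD(2)[OF \<phi>]
  let ?d = "\<lambda>x. frechet_derivative \<phi> (at x) b"
  let ?K = "closure {x. \<phi> x \<noteq> 0}"
  have cont: "continuous_on UNIV \<phi>" and contd: "continuous_on UNIV ?d" and K: "compact ?K"
    using test_functionD[OF \<phi>] b by auto
  \<comment> \<open>Taking the support itself as the domain sharpens vanishing off \<Omega> to
    vanishing off a compact set.\<close>
  have "\<phi> \<in> test_functions ?K"
    using \<phi> by (simp add: test_functions_def)
  then have 0: "\<phi> x = 0" "?d x = 0" if "x \<notin> ?K" for x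
    using test_functionD(5,6) that by blast+
  obtain B where B: "0 \<le> B" "\<And>x. \<bar>?d x\<bar> \<le> B"
    using continuous_compact_support_bounded[OF contd K 0(2)] by blast
  obtain C where C: "0 \<le> C" "\<And>x. \<bar>\<phi> x\<bar> \<le> C"
    using continuous_compact_support_bounded[OF cont K 0(1)] by blast
  obtain R where R: "\<And>x. x \<in> ?K \<Longrightarrow> norm x \<le> R"
    using compact_imp_bounded[OF K] by (auto simp: bounded_iff)
  \<comment> \<open>The argument runs over \<open>lborel\<close>, for which translation invariance
    is \<open>lborel_distr_plus\<close>; the integrand is Borel, so the result passes to the
    completion at the end.\<close>
  have meas: "\<phi> \<in> borel_measurable lborel" "?d \<in> borel_measurable lborel"
    using cont contd by (simp_all add: borel_measurable_continuous_onI)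
  have int_cball: "integrable lborel (\<lambda>x::'a. c * indicator (cball 0 r) x)" for c r :: real
  proof -
    have "cball (0 :: 'a) r \<in> fmeasurable lborel"
      by (intro fmeasurable_compact compact_cball)
    then have "integrable lborel (indicator (cball (0 :: 'a) r) :: 'a \<Rightarrow> real)"
      by (intro integrable_real_indicator) (auto simp: fmeasurable_def)
    then show ?thesis
      by (rule integrable_mult_right)
  qed
  have int: "integrable lborel \<phi>"
  proof (rule Bochner_Integration.integrable_bound[OF int_cball[of C R] meas(1)])
    show "AE x in lborel. norm (\<phi> x) \<le> norm (C * indicator (cball 0 R) x)"
    proof (rule AE_I2)
      fix x
      show "norm (\<phi> x) \<le> norm (C * indicator (cball 0 R) x)"
        using C 0(1)[of x] R[of x] by (cases "x \<in> ?K") auto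
    qed
  qed
  define q where "q n x = (\<phi> (x + inverse (real (Suc n)) *\<^sub>R b) - \<phi> x) / inverse (real (Suc n))" for n x
  have shift: "integrable lborel (\<lambda>x. \<phi> (x + c))" "(LINT x|lborel. \<phi> (x + c)) = (LINT x|lborel. \<phi> x)" for c
  proof -
    have "integrable (distr lborel borel ((+) c)) \<phi>"
      using int by (simp add: lborel_distr_plus)
    from integrable_distr[OF _ this] show "integrable lborel (\<lambda>x. \<phi> (x + c))"
      by (simp add: add.commute)
    have "(LINT x|distr lborel borel ((+) c). \<phi> x) = (LINT x|lborel. \<phi> (c + x))"
      using meas(1) by (intro integral_distr) auto
    then show "(LINT x|lborel. \<phi> (x + c)) = (LINT x|lborel. \<phi> x)"
      by (simp add: lborel_distr_plus add.commute)
  qed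
  have q_int: "(LINT x|lborel. q n x) = 0" for n
    unfolding q_def using shift int by simp
  have "(\<lambda>n. LINT x|lborel. q n x) \<longlonglongrightarrow> (LINT x|lborel. ?d x)"
  \<comment> \<open>By the mean value theorem a difference quotient is a value of the derivative,
    hence at most B in absolute value. A step of length at most 1 along a unit vector cannot reach
    the ball of radius R from outside the ball of radius R + 1.\<close>
  proof (rule integral_dominated_convergence[where w = "\<lambda>x. B * indicator (cball 0 (R + 1)) x"])
    show "?d \<in> borel_measurable lborel"
      by (rule meas)
    show "q n \<in> borel_measurable lborel" for n
      unfolding q_def[abs_def] using shift(1) meas(1) by (intro borel_measurable_divide borel_measurable_diff) auto
    show "integrable lborel (\<lambda>x::'a. B * indicator (cball 0 (R + 1)) x)"
      by (rule int_cball)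
    have line: "((\<lambda>t. \<phi> (x + t *\<^sub>R b)) has_real_derivative ?d (x + t *\<^sub>R b)) (at t)" for x t
    proof -
      have "((\<lambda>t. x + t *\<^sub>R b) has_derivative (\<lambda>t. t *\<^sub>R b)) (at t)"
        by (auto intro!: derivative_eq_intros)
      then have "((\<lambda>t. \<phi> (x + t *\<^sub>R b)) has_derivative (\<lambda>s. frechet_derivative \<phi> (at (x + t *\<^sub>R b)) (s *\<^sub>R b))) (at t)"
        by (rule has_derivative_compose) (rule D)
      moreover have "frechet_derivative \<phi> (at (x + t *\<^sub>R b)) (s *\<^sub>R b) = ?d (x + t *\<^sub>R b) * s" for s
        using linear_scale[OF has_derivative_linear[OF D], of _ s b] by simp
      ultimately show ?thesis
        by (simp only: has_field_derivative_def)
    qed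
    show "AE x in lborel. (\<lambda>n. q n x) \<longlonglongrightarrow> ?d x"
    proof (rule AE_I2)
      fix x
      have "((\<lambda>h. (\<phi> (x + h *\<^sub>R b) - \<phi> x) / h) \<longlongrightarrow> ?d x) (at 0)"
        using line[of x 0] by (simp add: DERIV_def)
      moreover have "filterlim (\<lambda>n. inverse (real (Suc n))) (at 0) sequentially"
        using LIMSEQ_inverse_real_of_nat by (simp add: filterlim_at)
      ultimately show "(\<lambda>n. q n x) \<longlonglongrightarrow> ?d x"
        unfolding q_def by (rule filterlim_compose)
    qed
    show "AE x in lborel. norm (q n x) \<le> B * indicator (cball 0 (R + 1)) x" for n
    proof (rule AE_I2)
      fix x
      define t where "t = inverse (real (Suc n))"
      have t: "0 < t" "t \<le> 1"
        by (auto simp: t_def field_simps)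
      have q: "q n x = (\<phi> (x + t *\<^sub>R b) - \<phi> x) / t"
        by (simp only: q_def t_def)
      show "norm (q n x) \<le> B * indicator (cball 0 (R + 1)) x"
      proof (cases "x \<in> cball 0 (R + 1)")
        case True
        have "\<exists>z::real. z > 0 \<and> z < t \<and> \<phi> (x + t *\<^sub>R b) - \<phi> (x + 0 *\<^sub>R b) = (t - 0) * ?d (x + z *\<^sub>R b)"
          by (rule MVT2[OF t(1)]) (rule line)
        then obtain z where "\<phi> (x + t *\<^sub>R b) - \<phi> x = t * ?d (x + z *\<^sub>R b)"
          by auto
        then have "q n x = ?d (x + z *\<^sub>R b)"
          using t by (simp add: q)
        then show ?thesis
          using B(2) True by simp
      next
        case False
        then have "norm x > R + 1"
          by simp
        moreover have "norm x \<le> norm (x + t *\<^sub>R b) + t"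
          using norm_triangle_ineq4[of "x + t *\<^sub>R b" "t *\<^sub>R b"] t b by simp
        ultimately have K: "x \<notin> ?K" "x + t *\<^sub>R b \<notin> ?K"
          using R[of x] R[of "x + t *\<^sub>R b"] t by auto
        show ?thesis
          using 0(1)[OF K(1)] 0(1)[OF K(2)] False by (simp add: q)
      qed
    qed
  qed
  then have "(LINT x|lborel. ?d x) = 0"
    by (simp add: q_int LIMSEQ_const_iff)
  then have "(LINT x|lebesgue. ?d x) = 0"
    using meas(2) by (simp add: integral_completion)
  moreover have "(\<lambda>x. indicator \<Omega> x *\<^sub>R ?d x) = ?d"
    using test_functionD(6)[OF \<phi>] by (auto simp: fun_eq_iff indicator_def)
  ultimately show ?thesis
    by (simp add: set_lebesgue_integral_def)
qed

text \<open>On a set of finite measure 1 + |g|^2 is an integrable majorant of |g|, because (|g| -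
  1)^2 is nonnegative. This supplies the integrability that the fundamental lemma requires of weak
  gradients.\<close>

lemma L2_imp_set_integrable_inner:
  fixes g :: "'a::euclidean_space \<Rightarrow> 'b::euclidean_space"
  assumes g: "g \<in> L2 \<Omega>" and \<Omega>: "\<Omega> \<in> lmeasurable"
  shows "set_integrable lebesgue \<Omega> (\<lambda>x. g x \<bullet> b)"
proof (rule set_integrable_bound)
  have "set_integrable lebesgue \<Omega> (\<lambda>x. (norm (g x))\<^sup>2)"
    using g by (simp add: L2_def)
  moreover have "set_integrable lebesgue \<Omega> (\<lambda>x. 1 :: real)"
    using \<Omega> by (simp add: set_integrable_def lmeasurable_iff_integrable)
  ultimately show "set_integrable lebesgue \<Omega> (\<lambda>x. norm b * (1 + (norm (g x))\<^sup>2))"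
    by (intro set_integrable_mult_right set_integral_add)
  have "(\<lambda>x. indicator \<Omega> x *\<^sub>R g x) \<in> borel_measurable lebesgue"
    using g by (simp add: L2_def set_borel_measurable_def)
  then have "(\<lambda>x. (indicator \<Omega> x *\<^sub>R g x) \<bullet> b) \<in> borel_measurable lebesgue"
    by (intro borel_measurable_inner) auto
  then show "set_borel_measurable lebesgue \<Omega> (\<lambda>x. g x \<bullet> b)"
    by (simp add: set_borel_measurable_def)
  show "AE x in lebesgue. x \<in> \<Omega> \<longrightarrow> norm (g x \<bullet> b) \<le> norm (norm b * (1 + (norm (g x))\<^sup>2))"
  proof (intro AE_I2 impI)
    fix x
    have "2 * norm (g x) \<le> 1 + (norm (g x))\<^sup>2"
      using zero_le_power2[of "norm (g x) - 1"] by (simp add: power2_diff)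
    then have "norm (g x) \<le> 1 + (norm (g x))\<^sup>2"
      using norm_ge_zero[of "g x"] by linarith
    then have "norm (g x) * norm b \<le> (1 + (norm (g x))\<^sup>2) * norm b"
      by (rule mult_right_mono) simp
    then show "norm (g x \<bullet> b) \<le> norm (norm b * (1 + (norm (g x))\<^sup>2))"
      using Cauchy_Schwarz_ineq2[of "g x" b] by (simp add: mult.commute)
  qed
qed

lemma set_integrable_mult_test_function:
  assumes f: "set_integrable lebesgue \<Omega> f" and \<phi>: "\<phi> \<in> test_functions \<Omega>"
  shows "set_integrable lebesgue \<Omega> (\<lambda>x. f x * \<phi> x)"
proof -
  let ?K = "closure {x. \<phi> x \<noteq> 0}"
  have "\<phi> x = 0" if "x \<notin> ?K" for x
    using that closure_subset[of "{x. \<phi> x \<noteq> 0}"] by blast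
  then obtain B where B: "0 \<le> B" "\<And>x. \<bar>\<phi> x\<bar> \<le> B"
    using continuous_compact_support_bounded[OF test_functionD(1,4)[OF \<phi>]] by blast
  show ?thesis
  proof (rule set_integrable_bound)
    show "set_integrable lebesgue \<Omega> (\<lambda>x. B * f x)"
      using f by simp
    have "(\<lambda>x. indicator \<Omega> x *\<^sub>R f x) \<in> borel_measurable lebesgue"
      using f unfolding set_integrable_def by (rule borel_measurable_integrable)
    then have "(\<lambda>x. (indicator \<Omega> x *\<^sub>R f x) * \<phi> x) \<in> borel_measurable lebesgue"
      using continuous_imp_borel_measurable_lebesgue[OF test_functionD(1)[OF \<phi>]]
      by (rule borel_measurable_times)
    then show "set_borel_measurable lebesgue \<Omega> (\<lambda>x. f x * \<phi> x)"
      by (simp add: set_borel_measurable_def mult.assoc)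
    show "AE x in lebesgue. x \<in> \<Omega> \<longrightarrow> norm (f x * \<phi> x) \<le> norm (B * f x)"
      using B by (intro AE_I2 impI) (simp add: abs_mult mult.commute mult_left_mono mult_right_mono)
  qed
qed

text \<open>Both fields pair with each test function to the same value, so every component of their
  difference is orthogonal to all test functions. The exceptional null sets of the finitely many
  components are then merged.\<close>

lemma weak_gradient_unique:
  assumes "open \<Omega>" "bounded \<Omega>" and g: "is_weak_gradient \<Omega> v g" and h: "is_weak_gradient \<Omega> v h"
  shows "AE x in lebesgue. x \<in> \<Omega> \<longrightarrow> g x = h x"
proof -
  have \<Omega>: "\<Omega> \<in> lmeasurable"
    using assms by (simp add: lmeasurable_open)
  have int: "set_integrable lebesgue \<Omega> (\<lambda>x. g x \<bullet> b)" "set_integrable lebesgue \<Omega> (\<lambda>x. h x \<bullet> b)" for b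
    using g h \<Omega> by (auto simp: is_weak_gradient_def intro: L2_imp_set_integrable_inner)
  have "AE x in lebesgue. x \<in> \<Omega> \<longrightarrow> g x \<bullet> b - h x \<bullet> b = 0" if b: "b \<in> Basis" for b
  proof (rule fundamental_lemma_calculus_of_variations[OF \<open>open \<Omega>\<close>])
    show "set_integrable lebesgue \<Omega> (\<lambda>x. g x \<bullet> b - h x \<bullet> b)"
      using int by (rule set_integral_diff)
    fix \<phi> assume \<phi>: "\<phi> \<in> test_functions \<Omega>"
    have "(LINT x:\<Omega>|lebesgue. (g x \<bullet> b - h x \<bullet> b) * \<phi> x) =
        (LINT x:\<Omega>|lebesgue. (g x \<bullet> b) * \<phi> x) - (LINT x:\<Omega>|lebesgue. (h x \<bullet> b) * \<phi> x)"
      unfolding left_diff_distrib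
      by (intro set_integral_diff set_integrable_mult_test_function int \<phi>)
    also have "\<dots> = 0"
    proof -
      have "- (LINT x:\<Omega>|lebesgue. (g x \<bullet> b) * \<phi> x) = - (LINT x:\<Omega>|lebesgue. (h x \<bullet> b) * \<phi> x)"
        using g h b \<phi> unfolding is_weak_gradient_def by metis
      then show ?thesis
        by simp
    qed
    finally show "(LINT x:\<Omega>|lebesgue. (g x \<bullet> b - h x \<bullet> b) * \<phi> x) = 0" .
  qed
  then have "AE x in lebesgue. \<forall>b\<in>Basis. x \<in> \<Omega> \<longrightarrow> g x \<bullet> b - h x \<bullet> b = 0"
    by (subst AE_ball_countable) (auto simp: countable_finite)
  then show ?thesis
    by eventually_elim (auto intro: euclidean_eqI)
qed

lemma is_weak_gradient_const:
  fixes \<Omega> :: "'a::euclidean_space set"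
  shows "is_weak_gradient \<Omega> (\<lambda>_. c) (\<lambda>_. 0)"
  unfolding is_weak_gradient_def
proof (intro conjI ballI)
  show "(\<lambda>_. 0) \<in> L2 \<Omega>"
    by (simp add: L2_def set_borel_measurable_def set_integrable_def)
  fix \<phi> and b :: 'a assume "\<phi> \<in> test_functions \<Omega>" "b \<in> Basis"
  then show "(LINT x:\<Omega>|lebesgue. c * frechet_derivative \<phi> (at x) b) = - (LINT x:\<Omega>|lebesgue. (0 \<bullet> b) * \<phi> x)"
    by (simp add: integral_frechet_derivative_test_function)
qed

subsection \<open>The finite element space and the scheme\<close>

lemma const_in_V_h:
  assumes "\<Omega> \<in> lmeasurable"
  shows "(\<lambda>_. c) \<in> V_h \<Omega> \<T>"
proof -
  have "(\<lambda>_. c) \<in> L2 \<Omega>"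
    using assms by (auto simp: L2_def set_borel_measurable_def set_integrable_def lmeasurable_iff_integrable
      intro: borel_measurable_integrable)
  moreover have "\<exists>p\<in>P1. AE x in lebesgue. x \<in> K \<longrightarrow> c = p x" for K
  proof
    show "(\<lambda>_. c) \<in> P1"
      unfolding P1_def by (rule CollectI, rule exI[of _ c], rule exI[of _ 0]) simp
  qed simp
  ultimately show ?thesis
    using is_weak_gradient_const[of \<Omega> c] by (auto simp: V_h_def H1_def)
qed

lemma weak_grad_const:
  assumes "open \<Omega>" "bounded \<Omega>"
  shows "AE x in lebesgue. x \<in> \<Omega> \<longrightarrow> weak_grad \<Omega> (\<lambda>_. c) x = 0"
proof -
  have "is_weak_gradient \<Omega> (\<lambda>_. c) (weak_grad \<Omega> (\<lambda>_. c))"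
    unfolding weak_grad_def
    by (rule someI[of "is_weak_gradient \<Omega> (\<lambda>_. c)", OF is_weak_gradient_const])
  then show ?thesis
    by (rule weak_gradient_unique[OF assms _ is_weak_gradient_const])
qed

section \<open>Essential bounds and integrability on the finite element space\<close>

lemma V_h_AE_bounded:
  assumes \<T>: "conforming_triangulation \<Omega> \<T>" and v: "v \<in> V_h \<Omega> \<T>"
  obtains B where "AE x in lebesgue. x \<in> \<Omega> \<longrightarrow> \<bar>v x\<bar> \<le> B"
proof -
  have fin: "finite \<T>" and cover: "\<Union>\<T> = closure \<Omega>"
    using \<T> by (auto simp: conforming_triangulation_def triangulation_def)
  have "\<exists>B. AE x in lebesgue. x \<in> K \<longrightarrow> \<bar>v x\<bar> \<le> B" if K: "K \<in> \<T>" for K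
  proof -
    obtain p where p: "p \<in> P1" "AE x in lebesgue. x \<in> K \<longrightarrow> v x = p x"
      using v K by (auto simp: V_h_def)
    have "compact K"
      using \<T> K by (auto simp: conforming_triangulation_def intro: simplex_imp_polytope polytope_imp_compact)
    moreover have "continuous_on K p"
    proof -
      obtain c a where "p = (\<lambda>x. c + a \<bullet> x)"
        using p(1) by (auto simp: P1_def)
      then show ?thesis
        by (simp add: continuous_on_add continuous_on_inner)
    qed
    ultimately have "bounded (p ` K)"
      by (intro compact_imp_bounded compact_continuous_image)
    then obtain B where B: "\<And>x. x \<in> K \<Longrightarrow> \<bar>p x\<bar> \<le> B"
      by (auto simp: bounded_iff)
    with p(2) have "AE x in lebesgue. x \<in> K \<longrightarrow> \<bar>v x\<bar> \<le> B"
      by eventually_elim (use B in auto)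
    then show ?thesis ..
  qed
  then obtain B where B: "\<And>K. K \<in> \<T> \<Longrightarrow> AE x in lebesgue. x \<in> K \<longrightarrow> \<bar>v x\<bar> \<le> B K"
    by metis
  have "AE x in lebesgue. \<forall>K\<in>\<T>. x \<in> K \<longrightarrow> \<bar>v x\<bar> \<le> B K"
    using B fin by (subst AE_ball_countable) (auto simp: countable_finite)
  \<comment> \<open>With absolute values the sum dominates each of its terms, whatever the sign of
    \<open>B K\<close>.\<close>
  then have "AE x in lebesgue. x \<in> \<Omega> \<longrightarrow> \<bar>v x\<bar> \<le> (\<Sum>K\<in>\<T>. \<bar>B K\<bar>)"
  proof eventually_elim
    case (elim x)
    show ?case
    proof
      assume "x \<in> \<Omega>"
      then obtain K where K: "K \<in> \<T>" "x \<in> K"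
        using cover closure_subset by blast
      then have "\<bar>v x\<bar> \<le> \<bar>B K\<bar>"
        using elim by force
      also have "\<dots> \<le> (\<Sum>K\<in>\<T>. \<bar>B K\<bar>)"
        using fin K by (intro member_le_sum) auto
      finally show "\<bar>v x\<bar> \<le> (\<Sum>K\<in>\<T>. \<bar>B K\<bar>)" .
    qed
  qed
  then show ?thesis
    by (rule that)
qed

text \<open>The gradient-free integrands of the theorem are all continuous functions of the pair of
  discrete solutions. Almost everywhere that pair stays in a compact rectangle, on which F is
  bounded.\<close>

lemma set_integrable_continuous_compose_V_h:
  fixes F :: "real \<times> real \<Rightarrow> real"
  assumes \<Omega>: "\<Omega> \<in> lmeasurable" and \<T>: "conforming_triangulation \<Omega> \<T>"
    and u: "u \<in> V_h \<Omega> \<T>" and w: "w \<in> V_h \<Omega> \<T>" and F: "continuous_on UNIV F"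
  shows "set_integrable lebesgue \<Omega> (\<lambda>x. F (u x, w x))"
proof -
  obtain A B where A: "AE x in lebesgue. x \<in> \<Omega> \<longrightarrow> \<bar>u x\<bar> \<le> A" and B: "AE x in lebesgue. x \<in> \<Omega> \<longrightarrow> \<bar>w x\<bar> \<le> B"
    using V_h_AE_bounded[OF \<T> u] V_h_AE_bounded[OF \<T> w] by metis
  have "bounded (F ` ({-A..A} \<times> {-B..B}))"
    using F by (intro compact_imp_bounded compact_continuous_image compact_Times)
      (auto intro: continuous_on_subset)
  then obtain C where C: "\<And>a b. a \<in> {-A..A} \<Longrightarrow> b \<in> {-B..B} \<Longrightarrow> \<bar>F (a, b)\<bar> \<le> C"
    by (force simp: bounded_iff)
  show ?thesis
  proof (rule set_integrable_bound)
    show "set_integrable lebesgue \<Omega> (\<lambda>x. C)"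
      using \<Omega> by (simp add: set_integrable_def lmeasurable_iff_integrable)
    \<comment> \<open>Only the products of u and w with the indicator of \<Omega> are known to be
      measurable, so F is composed with these. Off \<Omega> this gives \<open>F (0, 0)\<close>,
      possibly nonzero, hence the second multiplication by the indicator.\<close>
    have "(\<lambda>x. indicator \<Omega> x *\<^sub>R u x) \<in> borel_measurable lebesgue" "(\<lambda>x. indicator \<Omega> x *\<^sub>R w x) \<in> borel_measurable lebesgue"
      using u w by (simp_all add: V_h_def H1_def L2_def set_borel_measurable_def)
    then have "(\<lambda>x. F (indicator \<Omega> x *\<^sub>R u x, indicator \<Omega> x *\<^sub>R w x)) \<in> borel_measurable lebesgue"
      by (intro borel_measurable_continuous_on[OF F] borel_measurable_Pair)
    then have "(\<lambda>x. indicator \<Omega> x *\<^sub>R F (indicator \<Omega> x *\<^sub>R u x, indicator \<Omega> x *\<^sub>R w x)) \<in> borel_measurable lebesgue"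
      by (intro borel_measurable_scaleR borel_measurable_indicator fmeasurableD[OF \<Omega>])
    also have "(\<lambda>x. indicator \<Omega> x *\<^sub>R F (indicator \<Omega> x *\<^sub>R u x, indicator \<Omega> x *\<^sub>R w x)) =
        (\<lambda>x. indicator \<Omega> x *\<^sub>R F (u x, w x))"
      by (auto simp: fun_eq_iff indicator_def)
    finally show "set_borel_measurable lebesgue \<Omega> (\<lambda>x. F (u x, w x))"
      by (simp add: set_borel_measurable_def)
    show "AE x in lebesgue. x \<in> \<Omega> \<longrightarrow> norm (F (u x, w x)) \<le> norm C"
      using A B
    proof eventually_elim
      case (elim x)
      show ?case
        using elim C[of "u x" "w x"] by (auto simp: abs_le_iff)
    qed
  qed
qed

theorem theorem2p1:
  fixes \<Omega> :: "'a::euclidean_space set" and \<Omega>\<^sub>h :: "'a set set"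
    and m \<Delta>t :: real and u_old u_new :: "'a \<Rightarrow> real"
  assumes "DIM('a) \<in> {1, 2, 3}"
    and "bounded_polyhedral_domain \<Omega>"
    and "conforming_triangulation \<Omega> \<Omega>\<^sub>h"
    and "m \<ge> 1" and "\<Delta>t > 0"
    and "u_old \<in> V_h \<Omega> \<Omega>\<^sub>h" and "u_new \<in> V_h \<Omega> \<Omega>\<^sub>h"
    and scheme: "\<forall>v\<in>V_h \<Omega> \<Omega>\<^sub>h.
          \<M> \<Omega> (\<lambda>x. (exp (u_new x) - exp (u_old x)) / \<Delta>t) v
          + \<A> \<Omega> (\<lambda>x. m * exp (m * u_old x)) u_new v = 0"
  shows "\<M> \<Omega> (\<lambda>x. exp (u_new x)) (\<lambda>x. 1) = \<M> \<Omega> (\<lambda>x. exp (u_old x)) (\<lambda>x. 1)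
    \<and> (\<forall>x\<in>\<Omega>. exp (u_new x) > 0)
    \<and> energy \<Omega> u_new - energy \<Omega> u_old
        \<le> - (LINT x:\<Omega>|lebesgue. m * \<Delta>t * exp (m * u_old x) * (norm (weak_grad \<Omega> u_new x))\<^sup>2)"
proof (intro conjI ballI)
  have "open \<Omega>" "bounded \<Omega>"
    using assms(2) by (auto simp: bounded_polyhedral_domain_def)
  then have \<Omega>: "\<Omega> \<in> lmeasurable"
    by (simp add: lmeasurable_open)
  \<comment> \<open>The order of the facts fixes the pair as \<open>(u_new x, u_old x)\<close>: in
    the instances below a stands for the new and b for the old value.\<close>
  note int = set_integrable_continuous_compose_V_h[OF \<Omega> assms(3) assms(7) assms(6)]
  have int_new: "set_integrable lebesgue \<Omega> (\<lambda>x. exp (u_new x))"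
    using int[of "\<lambda>(a, b). exp a"] by (simp add: case_prod_beta continuous_intros)
  have int_old: "set_integrable lebesgue \<Omega> (\<lambda>x. exp (u_old x))"
    using int[of "\<lambda>(a, b). exp b"] by (simp add: case_prod_beta continuous_intros)
  have int_energy_new: "set_integrable lebesgue \<Omega> (\<lambda>x. exp (u_new x) * (u_new x - 1))"
    using int[of "\<lambda>(a, b). exp a * (a - 1)"] by (simp add: case_prod_beta continuous_intros)
  have int_energy_old: "set_integrable lebesgue \<Omega> (\<lambda>x. exp (u_old x) * (u_old x - 1))"
    using int[of "\<lambda>(a, b). exp b * (b - 1)"] by (simp add: case_prod_beta continuous_intros)
  have int_test: "set_integrable lebesgue \<Omega> (\<lambda>x. (exp (u_new x) - exp (u_old x)) * u_new x)"
    using int[of "\<lambda>(a, b). (exp a - exp b) * a"] by (simp add: case_prod_beta continuous_intros)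
  have \<M>_diff: "\<M> \<Omega> (\<lambda>x. (exp (u_new x) - exp (u_old x)) / \<Delta>t) v
      = (LINT x:\<Omega>|lebesgue. (exp (u_new x) - exp (u_old x)) * v x) / \<Delta>t" for v
    by (simp add: \<M>_def)

  have "\<A> \<Omega> (\<lambda>x. m * exp (m * u_old x)) u_new (\<lambda>_. 1) = 0"
    unfolding \<A>_def set_lebesgue_integral_def
  proof (rule integral_eq_zero_AE)
    show "AE x in lebesgue. indicator \<Omega> x *\<^sub>R
        (m * exp (m * u_old x) * (weak_grad \<Omega> u_new x \<bullet> weak_grad \<Omega> (\<lambda>_. 1) x)) = 0"
      using weak_grad_const[OF \<open>open \<Omega>\<close> \<open>bounded \<Omega>\<close>, of 1]
      by eventually_elim (auto simp: indicator_def)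
  qed
  with scheme const_in_V_h[OF \<Omega>, of 1 \<Omega>\<^sub>h]
  have "\<M> \<Omega> (\<lambda>x. (exp (u_new x) - exp (u_old x)) / \<Delta>t) (\<lambda>_. 1) = 0"
    by force
  then have "(LINT x:\<Omega>|lebesgue. exp (u_new x) - exp (u_old x)) = 0"
    using \<open>\<Delta>t > 0\<close> by (simp add: \<M>_diff)
  then show "\<M> \<Omega> (\<lambda>x. exp (u_new x)) (\<lambda>x. 1) = \<M> \<Omega> (\<lambda>x. exp (u_old x)) (\<lambda>x. 1)"
    using int_new int_old by (simp add: \<M>_def set_integral_diff)

  show "exp (u_new x) > 0" for x
    by simp

  have "energy \<Omega> u_new - energy \<Omega> u_old =
      (LINT x:\<Omega>|lebesgue. exp (u_new x) * (u_new x - 1) - exp (u_old x) * (u_old x - 1))"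
    unfolding energy_def \<M>_def using int_energy_new int_energy_old by (rule set_integral_diff(2)[symmetric])
  also have "\<dots> \<le> (LINT x:\<Omega>|lebesgue. (exp (u_new x) - exp (u_old x)) * u_new x)"
  proof (rule set_integral_mono)
    show "set_integrable lebesgue \<Omega> (\<lambda>x. exp (u_new x) * (u_new x - 1) - exp (u_old x) * (u_old x - 1))"
      using int_energy_new int_energy_old by (rule set_integral_diff)
    show "set_integrable lebesgue \<Omega> (\<lambda>x. (exp (u_new x) - exp (u_old x)) * u_new x)"
      by (rule int_test)
    \<comment> \<open>convexity of \<open>s \<mapsto> s * ln s - s\<close>, whose derivative at \<open>exp (u_new x)\<close> is \<open>u_new x\<close>\<close>
    show "exp (u_new x) * (u_new x - 1) - exp (u_old x) * (u_old x - 1) \<le> (exp (u_new x) - exp (u_old x)) * u_new x" for x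
    proof -
      \<comment> \<open>Once \<open>exp (u_new x) * u_new x\<close> cancels, the claim is exp s
        \<ge> 1 + s at s = \<open>u_new x - u_old x\<close>, scaled by
        \<open>exp (u_old x)\<close>.\<close>
      have "exp (u_old x) * (1 + (u_new x - u_old x)) \<le> exp (u_old x) * exp (u_new x - u_old x)"
        by (intro mult_left_mono exp_ge_add_one_self) simp
      also have "\<dots> = exp (u_new x)"
        by (simp flip: exp_add)
      finally show ?thesis
        by (simp add: algebra_simps)
    qed
  qed
  also have "\<dots> = \<Delta>t * \<M> \<Omega> (\<lambda>x. (exp (u_new x) - exp (u_old x)) / \<Delta>t) u_new"
    using \<open>\<Delta>t > 0\<close> by (simp add: \<M>_diff)
  also have "\<dots> = - (\<Delta>t * \<A> \<Omega> (\<lambda>x. m * exp (m * u_old x)) u_new u_new)"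
    using bspec[OF scheme assms(7)] by (simp add: add_eq_0_iff)
  also have "\<Delta>t * \<A> \<Omega> (\<lambda>x. m * exp (m * u_old x)) u_new u_new =
      (LINT x:\<Omega>|lebesgue. \<Delta>t * (m * exp (m * u_old x) * (weak_grad \<Omega> u_new x \<bullet> weak_grad \<Omega> u_new x)))"
    by (simp only: \<A>_def set_integral_mult_right)
  \<comment> \<open>Both slots hold the same chosen representative of the gradient, so the inner
    product is the squared norm pointwise, without appeal to uniqueness.\<close>
  also have "(\<lambda>x. \<Delta>t * (m * exp (m * u_old x) * (weak_grad \<Omega> u_new x \<bullet> weak_grad \<Omega> u_new x))) =
      (\<lambda>x. m * \<Delta>t * exp (m * u_old x) * (norm (weak_grad \<Omega> u_new x))\<^sup>2)"
    by (simp add: power2_norm_eq_inner mult_ac)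
  finally show "energy \<Omega> u_new - energy \<Omega> u_old
      \<le> - (LINT x:\<Omega>|lebesgue. m * \<Delta>t * exp (m * u_old x) * (norm (weak_grad \<Omega> u_new x))\<^sup>2)" .
qed

end
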